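(* Let $\alpha_1\ge0$, $\alpha_2>0$, $0<\zeta\le1$, $\mu\ge1$ and let $f\in Lip_M^{(\alpha_1,\alpha_2)}(\zeta)$. Then for all $x\in(0,1]$, $$\big|D^{M,1}_{n,\mu}(f;x)-f(x)\big|\le C\left(\frac{\mu\,B_{a_0,a_1}\,\varphi^2(x)}{(n+2)(\alpha_1x^2+\alpha_2x)}\right)^{\zeta/2},$$ where $C$ is an absolute constant.
   Context: Here $p_{n,k}(x)=\binom{n}{k}x^k(1-x)^{n-k}$ for $0\le k\le n$, and $p_{n,k}(x)=0$ if $k<0$ or $k>n$. Let $a_0(n),a_1(n)$ be real sequences with $2a_0(n)+a_1(n)=1$; put $a(x,n)=a_1(n)x+a_0(n)$ and $$p^{M,1}_{n,k}(x)=a(x,n)\,p_{n-1,k}(x)+a(1-x,n)\,p_{n-1,k-1}(x),$$ $$D^{M,1}_n(f;x)=(n+1)\sum_{k=0}^n p^{M,1}_{n,k}(x)\int_0^1 p_{n,k}(u)f(u)\,du .$$ For $\mu\ge1$ the Bézier variant is $$D^{M,1}_{n,\mu}(f;x)=(n+1)\sum_{k=0}^n Q^{(\mu)}_{n,k}(x)\int_0^1p_{n,k}(u)f(u)\,du,$$ $$Q^{(\mu)}_{n,k}(x)=(J_{n,k}(x))^\mu-(J_{n,k+1}(x))^\mu,\qquad J_{n,k}(x)=\sum_{j=k}^n p^{M,1}_{n,j}(x),\quad J_{n,n+1}(x)=0.$$ $\varphi^2(x)=x(1-x)$, and $B_{a_0,a_1}$ denotes a positive constant depending on $a_0$ and $a_1$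 such that $D^{M,1}_n((u-x)^2;x)\le \frac{B_{a_0,a_1}}{n+2}\varphi^2(x)$ for $x\in[0,1]$. The Lipschitz-type space is $$Lip_M^{(\alpha_1,\alpha_2)}(\zeta)=\left\{f\in C[0,1]:|f(t)-f(x)|\le C_0\frac{|t-x|^\zeta}{(t+\alpha_1x^2+\alpha_2x)^{\zeta/2}},\ t\in[0,1],\ x\in(0,1)\right\},$$ where $C_0$ is an absolute constant.
   Formalization: It is additionally assumed that J_{n,k} ≥ 0 on [0,1] for the given n (needed for real powers; the claim fails e.g. for a_0=3/2, a_1=-2, μ=1, f(u)=u, x=1); the bound defining B is required only at the n and x considered; C depends on C_0. *)

theory Defs
  imports "HOL-Analysis.Analysis"
begin

text \<open>The lower index is an integer because \<open>p\<^sub>n\<^sub>,\<^sub>k = 0\<close> is used for \<open>k = -1\<close>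
  and for \<open>k > n\<close>.\<close>
definition bern :: "nat \<Rightarrow> int \<Rightarrow> real \<Rightarrow> real" where
  "bern n k x = (if 0 \<le> k \<and> k \<le> int n then Bernstein n (nat k) x else 0)"

definition acoef :: "(nat \<Rightarrow> real) \<Rightarrow> (nat \<Rightarrow> real) \<Rightarrow> real \<Rightarrow> nat \<Rightarrow> real" where
  "acoef a0 a1 x n = a1 n * x + a0 n"

text \<open>Meaningful for \<open>n \<ge> 1\<close> only: \<open>n - 1\<close> is truncated subtraction.\<close>
definition pM :: "(nat \<Rightarrow> real) \<Rightarrow> (nat \<Rightarrow> real) \<Rightarrow> nat \<Rightarrow> nat \<Rightarrow> real \<Rightarrow> real" where
  "pM a0 a1 n k x =
     acoef a0 a1 x n * bern (n - 1) (int k) x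
     + acoef a0 a1 (1 - x) n * bern (n - 1) (int k - 1) x"

definition DM :: "(nat \<Rightarrow> real) \<Rightarrow> (nat \<Rightarrow> real) \<Rightarrow> nat \<Rightarrow> (real \<Rightarrow> real) \<Rightarrow> real \<Rightarrow> real" where
  "DM a0 a1 n f x =
     (real n + 1) * (\<Sum>k=0..n. pM a0 a1 n k x * integral {0..1} (\<lambda>u. bern n (int k) u * f u))"

text \<open>The sum is empty, hence 0, for \<open>k = n + 1\<close>.\<close>
definition JM :: "(nat \<Rightarrow> real) \<Rightarrow> (nat \<Rightarrow> real) \<Rightarrow> nat \<Rightarrow> nat \<Rightarrow> real \<Rightarrow> real" where
  "JM a0 a1 n k x = (\<Sum>j=k..n. pM a0 a1 n j x)"

text \<open>The exponent \<open>\<mu>\<close> is real, so the powers are the intended ones only where \<open>JM\<close> is nonnegative;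
  note that \<open>0 powr \<mu> = 0\<close>.\<close>
definition QM :: "(nat \<Rightarrow> real) \<Rightarrow> (nat \<Rightarrow> real) \<Rightarrow> real \<Rightarrow> nat \<Rightarrow> nat \<Rightarrow> real \<Rightarrow> real" where
  "QM a0 a1 \<mu> n k x = JM a0 a1 n k x powr \<mu> - JM a0 a1 n (k + 1) x powr \<mu>"

definition DM_Bezier ::
    "(nat \<Rightarrow> real) \<Rightarrow> (nat \<Rightarrow> real) \<Rightarrow> real \<Rightarrow> nat \<Rightarrow> (real \<Rightarrow> real) \<Rightarrow> real \<Rightarrow> real" where
  "DM_Bezier a0 a1 \<mu> n f x =
     (real n + 1) * (\<Sum>k=0..n. QM a0 a1 \<mu> n k x * integral {0..1} (\<lambda>u. bern n (int k) u * f u))"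

definition phi2 :: "real \<Rightarrow> real" where
  "phi2 x = x * (1 - x)"

text \<open>The Lipschitz constant \<open>C0\<close> is a parameter of the space, so that it can be fixed
  independently of its elements.\<close>
definition Lip :: "real \<Rightarrow> real \<Rightarrow> real \<Rightarrow> real \<Rightarrow> (real \<Rightarrow> real) set" where
  "Lip C0 \<alpha>1 \<alpha>2 \<zeta> =
     {f. continuous_on {0..1} f \<and>
         (\<forall>t\<in>{0..1}. \<forall>x\<in>{0<..<1}.
            \<bar>f t - f x\<bar> \<le> C0 * (\<bar>t - x\<bar> powr \<zeta> / (t + \<alpha>1 * x\<^sup>2 + \<alpha>2 * x) powr (\<zeta> / 2)))}"

end

theory Submission
  imports Defs
begin

text \<open>The hypothesis \<open>JM \<ge> 0\<close> at \<open>(k, y) = (n, 1)\<close> and \<open>(1, 0)\<close> says \<open>0 \<le> a0 n \<le> 1\<close>, so all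
  \<open>pM\<close> are nonnegative, with sum 1. The mean value theorem then gives \<open>0 \<le> QM \<le> \<mu> * pM\<close>, and
  \<open>DM_Bezier\<close> is a positive functional that fixes constants and is at most \<open>\<mu> * DM\<close> on nonnegative
  functions. The Lipschitz condition bounds \<open>\<bar>f u - f x\<bar>\<close> by a constant times
  \<open>((u - x)\<^sup>2) powr (\<zeta> / 2)\<close>. In place of Hoelder's inequality, this concave power is replaced by its
  tangent at an arbitrary \<open>\<delta> > DM_Bezier ((u - x)\<^sup>2)\<close>, which is affine in \<open>(u - x)\<^sup>2\<close>.\<close>

section \<open>Bernstein polynomials and their integrals over the unit interval\<close>

lemma continuous_on_bern: "continuous_on S (bern n k)"
  unfolding bern_def Bernstein_def by (cases "0 \<le> k \<and> k \<le> int n") (auto intro!: continuous_intros)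

lemma bern_nonneg: "0 \<le> x \<Longrightarrow> x \<le> 1 \<Longrightarrow> 0 \<le> bern n k x"
  by (simp add: bern_def Bernstein_nonneg)

lemma bern_of_nat: "k \<le> n \<Longrightarrow> bern n (int k) x = Bernstein n k x"
  by (simp add: bern_def)

lemma bern_mult_integrable:
  "continuous_on {0..1} f \<Longrightarrow> (\<lambda>u. bern n k u * f u) integrable_on {0..1}"
  by (intro integrable_continuous_real continuous_intros continuous_on_bern)

lemma Bernstein_integrable: "Bernstein n k integrable_on {0..1}"
  unfolding Bernstein_def by (intro integrable_continuous_real continuous_intros)

lemma Bernstein_has_derivative:
  assumes "k < n"
  shows "(Bernstein (Suc n) (Suc k) has_real_derivative
           (real n + 1) * (Bernstein n k x - Bernstein n (Suc k) x)) (at x within S)"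
proof -
  \<comment> \<open>With \<open>n = Suc (k + d)\<close> the exponents of \<open>1 - x\<close> become
    \<open>Suc d\<close> and \<open>d\<close>, free of truncated subtraction.\<close>
  obtain d where n: "n = Suc (k + d)"
    using assms less_iff_Suc_add by auto
  \<comment> \<open>\<open>1\<close> and \<open>2\<close> are absorption identities; they turn the
    two product-rule coefficients into binomial coefficients of degree \<open>n\<close>.\<close>
  have 1: "(1 + real k) * real (Suc n choose Suc k) = (real n + 1) * real (n choose k)"
    using arg_cong[OF Suc_times_binomial[of k n], of real]
    by (simp del: binomial_Suc_Suc add: algebra_simps)
  have 2: "(1 + real d) * real (Suc n choose Suc k) = (real n + 1) * real (n choose Suc k)"
  proof -
    have "(Suc n - Suc k) * (Suc n choose Suc k) = Suc n * (n choose Suc k)"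
      by (rule binomial_absorb_comp[of "Suc n" "Suc k", simplified diff_Suc_1])
    then have "Suc d * (Suc n choose Suc k) = Suc n * (n choose Suc k)"
      by (simp add: n del: binomial_Suc_Suc)
    from arg_cong[OF this, of real] show ?thesis
      by (simp del: binomial_Suc_Suc add: n algebra_simps)
  qed
  have "((\<lambda>x. real (Suc n choose Suc k) * x ^ Suc k * (1 - x) ^ Suc d) has_real_derivative
          (1 + real k) * real (Suc n choose Suc k) * (x ^ k * (1 - x) ^ Suc d)
          - (1 + real d) * real (Suc n choose Suc k) * (x ^ Suc k * (1 - x) ^ d)) (at x within S)"
  proof -
    have pow: "((\<lambda>x. x ^ Suc k) has_real_derivative (1 + real k) * x ^ k) (at x within S)"
      using DERIV_pow[of "Suc k" x S] by (simp del: power_Suc)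
    have "((\<lambda>x. (1 - x) ^ Suc d) has_real_derivative - ((1 + real d) * (1 - x) ^ d)) (at x within S)"
      by (auto intro!: derivative_eq_intros simp del: power_Suc)
    from DERIV_cmult[OF DERIV_mult[OF pow this], of "real (Suc n choose Suc k)"]
    show ?thesis
      by (simp del: binomial_Suc_Suc add: algebra_simps)
  qed
  then show ?thesis
    unfolding 1 2 by (simp add: Bernstein_def[abs_def] n algebra_simps del: binomial_Suc_Suc)
qed

text \<open>In place of the Beta integral: for \<open>j < n\<close>,
  \<open>Bernstein (Suc n) (Suc j)\<close> vanishes at 0 and 1, so integrating its derivative shows
  that neighbouring polynomials of degree \<open>n\<close> have equal integrals. These
  \<open>n + 1\<close> equal integrals add up to the integral of 1.\<close>

lemma integral_Bernstein:
  assumes "k \<le> n"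
  shows "(real n + 1) * integral {0..1} (Bernstein n k) = 1"
proof -
  have step: "integral {0..1} (Bernstein n (Suc j)) = integral {0..1} (Bernstein n j)" if "j < n" for j
  proof -
    have "((\<lambda>x. (real n + 1) * (Bernstein n j x - Bernstein n (Suc j) x)) has_integral
            (Bernstein (Suc n) (Suc j) 1 - Bernstein (Suc n) (Suc j) 0)) {0..1}"
      using Bernstein_has_derivative[OF that]
      by (intro fundamental_theorem_of_calculus)
        (auto simp: has_real_derivative_iff_has_vector_derivative)
    then have "integral {0..1} (\<lambda>x. (real n + 1) * (Bernstein n j x - Bernstein n (Suc j) x)) = 0"
      using that by (auto simp: Bernstein_def[of "Suc n"] power_0_left dest!: integral_unique)
    then show ?thesis
      using Bernstein_integrable by (simp add: integral_diff)
  qed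
  have const: "integral {0..1} (Bernstein n j) = integral {0..1} (Bernstein n 0)" if "j \<le> n" for j
    using that by (induction j) (auto simp: step)
  have "1 = integral {0..1} (\<lambda>x. \<Sum>j\<le>n. Bernstein n j x)"
    by simp
  also have "\<dots> = (\<Sum>j\<le>n. integral {0..1} (Bernstein n j))"
    by (rule integral_sum) (auto simp: Bernstein_integrable)
  also have "\<dots> = (\<Sum>j\<le>n. integral {0..1} (Bernstein n k))"
    by (intro sum.cong refl trans[OF const const[OF assms, symmetric]]) auto
  finally show ?thesis
    by (simp add: add.commute)
qed

section \<open>Durrmeyer functionals with free weights: \<open>pM\<close> gives \<open>DM\<close>,
  \<open>QM\<close> gives \<open>DM_Bezier\<close>\<close>

definition durrmeyer :: "nat \<Rightarrow> (nat \<Rightarrow> real) \<Rightarrow> (real \<Rightarrow> real) \<Rightarrow> real" where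
  "durrmeyer n w f =
     (real n + 1) * (\<Sum>k=0..n. w k * integral {0..1} (\<lambda>u. bern n (int k) u * f u))"

lemma durrmeyer_mono:
  assumes "\<And>k. k \<le> n \<Longrightarrow> 0 \<le> w k" "continuous_on {0..1} f" "continuous_on {0..1} g"
    and "\<And>u. u \<in> {0..1} \<Longrightarrow> f u \<le> g u"
  shows "durrmeyer n w f \<le> durrmeyer n w g"
  unfolding durrmeyer_def using assms
  by (intro mult_left_mono sum_mono integral_le bern_mult_integrable) (auto simp: bern_nonneg)

text \<open>A nonnegative \<open>f\<close> has nonnegative integrals against \<open>bern\<close>, so
  weights may be compared termwise. With \<open>c = \<mu>\<close> this carries the second-moment
  bound from \<open>DM\<close> to \<open>DM_Bezier\<close>.\<close>

lemma durrmeyer_mono_weights: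
  assumes "\<And>k. k \<le> n \<Longrightarrow> w k \<le> c * v k" "continuous_on {0..1} f"
    and "\<And>u. u \<in> {0..1} \<Longrightarrow> 0 \<le> f u"
  shows "durrmeyer n w f \<le> c * durrmeyer n v f"
proof -
  have "(\<Sum>k=0..n. w k * integral {0..1} (\<lambda>u. bern n (int k) u * f u))
      \<le> (\<Sum>k=0..n. (c * v k) * integral {0..1} (\<lambda>u. bern n (int k) u * f u))"
    using assms
    by (intro sum_mono mult_right_mono integral_nonneg bern_mult_integrable) (auto simp: bern_nonneg)
  also have "\<dots> = c * (\<Sum>k=0..n. v k * integral {0..1} (\<lambda>u. bern n (int k) u * f u))"
    by (simp add: sum_distrib_left mult.assoc)
  finally have "(real n + 1) * (\<Sum>k=0..n. w k * integral {0..1} (\<lambda>u. bern n (int k) u * f u))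
      \<le> (real n + 1) * (c * (\<Sum>k=0..n. v k * integral {0..1} (\<lambda>u. bern n (int k) u * f u)))"
    by (rule mult_left_mono) simp
  then show ?thesis
    by (simp add: durrmeyer_def mult.left_commute)
qed

text \<open>The factor \<open>n + 1\<close> normalises every Bernstein integral to 1, so a constant
  is only multiplied by the total weight.\<close>

lemma durrmeyer_affine:
  assumes "(\<Sum>k=0..n. w k) = 1" "continuous_on {0..1} s"
  shows "durrmeyer n w (\<lambda>u. p + q * s u) = p + q * durrmeyer n w s"
proof -
  have "(real n + 1) * (w k * integral {0..1} (\<lambda>u. bern n (int k) u * (p + q * s u)))
      = p * w k + q * ((real n + 1) * (w k * integral {0..1} (\<lambda>u. bern n (int k) u * s u)))"
    if "k \<le> n" for k
  proof -
    have one: "(real n + 1) * integral {0..1} (bern n (int k)) = 1"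
      using integral_Bernstein[OF that] by (simp add: bern_of_nat[OF that, abs_def])
    have int: "bern n (int k) integrable_on {0..1}"
      by (intro integrable_continuous_real continuous_on_bern)
    have "integral {0..1} (\<lambda>u. bern n (int k) u * (p + q * s u))
        = integral {0..1} (\<lambda>u. p * bern n (int k) u + q * (bern n (int k) u * s u))"
      by (simp add: algebra_simps)
    also have "\<dots> = p * integral {0..1} (bern n (int k))
        + q * integral {0..1} (\<lambda>u. bern n (int k) u * s u)"
      using int bern_mult_integrable[OF assms(2), of n "int k"]
      by (subst integral_add) (auto intro: integrable_on_mult_right)
    finally have "(real n + 1) * (w k * integral {0..1} (\<lambda>u. bern n (int k) u * (p + q * s u)))
        = p * w k * ((real n + 1) * integral {0..1} (bern n (int k)))
          + q * ((real n + 1) * (w k * integral {0..1} (\<lambda>u. bern n (int k) u * s u)))"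
      by (simp add: algebra_simps)
    then show ?thesis
      unfolding one by simp
  qed
  then have "durrmeyer n w (\<lambda>u. p + q * s u)
      = (\<Sum>k=0..n. p * w k + q * ((real n + 1) * (w k * integral {0..1} (\<lambda>u. bern n (int k) u * s u))))"
    unfolding durrmeyer_def sum_distrib_left by (intro sum.cong) auto
  also have "\<dots> = p + q * durrmeyer n w s"
    by (simp add: durrmeyer_def sum.distrib flip: sum_distrib_left) (simp add: assms(1))
  finally show ?thesis .
qed

section \<open>The weights: unit sum, sign, and comparison of \<open>QM\<close> with
  \<open>pM\<close>\<close>

lemma sum_pM:
  assumes "n \<ge> 1" "2 * a0 n + a1 n = 1"
  shows "(\<Sum>k=0..n. pM a0 a1 n k x) = 1"
proof -
  obtain m where n: "n = Suc m"
    using assms by (cases n) auto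
  \<comment> \<open>Each of the two sums has one vanishing term: \<open>k = n = m + 1\<close> here,
    and \<open>k = 0\<close> with index -1 in the shifted sum.\<close>
  have 1: "(\<Sum>k\<le>n. bern m (int k) x) = 1"
    using sum_Bernstein[of m x] by (simp add: n bern_def)
  have 2: "(\<Sum>k\<le>n. bern m (int k - 1) x) = 1"
    using sum_Bernstein[of m x] unfolding n sum.atMost_Suc_shift by (simp add: bern_def)
  have "(\<Sum>k\<le>n. pM a0 a1 n k x) = acoef a0 a1 x n + acoef a0 a1 (1 - x) n"
    using 1 2 unfolding pM_def by (simp add: n sum.distrib flip: sum_distrib_left)
  then show ?thesis
    using assms(2) by (simp add: acoef_def algebra_simps atLeast0AtMost)
qed

lemma pM_nonneg:
  assumes n: "n \<ge> 1" and a: "2 * a0 n + a1 n = 1"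
    and J: "\<And>k y. k \<le> n \<Longrightarrow> y \<in> {0..1} \<Longrightarrow> 0 \<le> JM a0 a1 n k y"
    and x: "x \<in> {0..1}"
  shows "0 \<le> pM a0 a1 n k x"
proof -
  obtain m where m: "n = Suc m"
    using n by (cases n) auto
  \<comment> \<open>At 1 only \<open>bern m m\<close> survives, with coefficient
    \<open>acoef a0 a1 0 n\<close>.\<close>
  have "JM a0 a1 n n 1 = a0 n"
    by (simp add: JM_def pM_def m bern_def Bernstein_def acoef_def)
  then have a0: "0 \<le> a0 n"
    using J[of n 1] by simp
  \<comment> \<open>Hence \<open>JM a0 a1 n 1 0 = 1 - a0 n\<close>, which is
    \<open>a1 n + a0 n\<close> by the normalisation.\<close>
  have "pM a0 a1 n 0 0 + JM a0 a1 n 1 0 = 1"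
    using sum_pM[of n a0 a1 0] n a by (simp add: JM_def sum.atLeast_Suc_atMost)
  moreover have "pM a0 a1 n 0 0 = a0 n"
    by (simp add: pM_def m bern_def Bernstein_def acoef_def)
  ultimately have a01: "0 \<le> a1 n + a0 n"
    using J[of 1 0] n a by simp
  have "0 \<le> acoef a0 a1 y n" if "y \<in> {0..1}" for y
  proof -
    \<comment> \<open>A convex combination of the values at 1 and 0, both already
      nonnegative.\<close>
    have "acoef a0 a1 y n = y * (a1 n + a0 n) + (1 - y) * a0 n"
      by (simp add: acoef_def algebra_simps)
    then show ?thesis
      using that a0 a01 by simp
  qed
  then show ?thesis
    using x by (simp add: pM_def bern_nonneg)
qed

text \<open>Mean value theorem: the derivative \<open>\<mu> * z powr (\<mu> - 1)\<close> is at most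
  \<open>\<mu>\<close> on \<open>(0, 1]\<close>. The case \<open>x = 0\<close> is settled directly
  by \<open>y powr \<mu> \<le> y \<le> \<mu> * y\<close>.\<close>

lemma powr_diff_le:
  fixes x y \<mu> :: real
  assumes "0 \<le> x" "x \<le> y" "y \<le> 1" "1 \<le> \<mu>"
  shows "y powr \<mu> - x powr \<mu> \<le> \<mu> * (y - x)"
proof (cases "x = 0 \<or> x = y")
  case True
  have "y powr \<mu> \<le> y"
    using assms by (cases "y = 0") (auto simp: powr_le_one_le)
  also have "y \<le> \<mu> * y"
    using assms mult_right_mono[of 1 \<mu> y] by simp
  finally show ?thesis
    using True assms by auto
next
  case False
  then have "0 < x" "x < y"
    using assms by auto
  moreover have "((\<lambda>z. z powr \<mu>) has_real_derivative \<mu> * z powr (\<mu> - 1)) (at z)" if "x \<le> z" for z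
    using that \<open>0 < x\<close> by (auto intro!: derivative_eq_intros simp: powr_diff)
  ultimately obtain z where z: "x < z" "z < y" "y powr \<mu> - x powr \<mu> = (y - x) * (\<mu> * z powr (\<mu> - 1))"
    using MVT2[of x y "\<lambda>z. z powr \<mu>" "\<lambda>z. \<mu> * z powr (\<mu> - 1)"] by auto
  have "z powr (\<mu> - 1) \<le> 1"
    using z \<open>0 < x\<close> assms by (simp add: powr_le1)
  then have "(y - x) * (\<mu> * z powr (\<mu> - 1)) \<le> (y - x) * (\<mu> * 1)"
    using assms by (intro mult_left_mono) auto
  then show ?thesis
    using z by (simp add: mult.commute)
qed

text \<open>Consecutive tails \<open>JM\<close> lie in \<open>[0, 1]\<close> and differ by
  \<open>pM\<close>, so monotonicity of the power gives the sign and \<open>powr_diff_le\<close> the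
  upper bound.\<close>

lemma QM_bounds:
  assumes p: "\<And>k. 0 \<le> pM a0 a1 n k x" and s: "(\<Sum>k=0..n. pM a0 a1 n k x) = 1"
    and \<mu>: "1 \<le> \<mu>" and k: "k \<le> n"
  shows "0 \<le> QM a0 a1 \<mu> n k x" "QM a0 a1 \<mu> n k x \<le> \<mu> * pM a0 a1 n k x"
proof -
  have J: "JM a0 a1 n k x = pM a0 a1 n k x + JM a0 a1 n (k + 1) x"
    using k by (simp add: JM_def sum.atLeast_Suc_atMost)
  have J0: "0 \<le> JM a0 a1 n (k + 1) x"
    unfolding JM_def by (intro sum_nonneg p)
  have J1: "JM a0 a1 n k x \<le> 1"
    unfolding JM_def s[symmetric] using p by (intro sum_mono2) auto
  show "0 \<le> QM a0 a1 \<mu> n k x"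
    unfolding QM_def using powr_mono2[of \<mu> "JM a0 a1 n (k + 1) x" "JM a0 a1 n k x"] p[of k] J0 J \<mu>
    by simp
  show "QM a0 a1 \<mu> n k x \<le> \<mu> * pM a0 a1 n k x"
    unfolding QM_def using powr_diff_le[of "JM a0 a1 n (k + 1) x" "JM a0 a1 n k x" \<mu>] p[of k] J0 J1 J \<mu>
    by simp
qed

text \<open>Telescoping leaves \<open>1 powr \<mu> - 0 powr \<mu>\<close>, since \<open>JM\<close>
  at \<open>Suc n\<close> is an empty sum.\<close>

lemma sum_QM:
  assumes "(\<Sum>k=0..n. pM a0 a1 n k x) = 1"
  shows "(\<Sum>k=0..n. QM a0 a1 \<mu> n k x) = 1"
proof -
  have "(\<Sum>k\<le>n. QM a0 a1 \<mu> n k x) = JM a0 a1 n 0 x powr \<mu> - JM a0 a1 n (Suc n) x powr \<mu>"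
    unfolding QM_def using sum_telescope[of "\<lambda>k. JM a0 a1 n k x powr \<mu>" n] by simp
  then show ?thesis
    using assms by (simp add: JM_def atLeast0AtMost)
qed

section \<open>Pointwise Lipschitz bound and its transfer to the functional\<close>

lemma Lip_bound:
  assumes f: "f \<in> Lip C0 \<alpha>1 \<alpha>2 \<zeta>" and "\<alpha>1 \<ge> 0" "\<alpha>2 > 0" "0 < \<zeta>"
    and t: "t \<in> {0..1}" and x: "x \<in> {0<..1}"
  shows "\<bar>f t - f x\<bar> \<le> \<bar>C0\<bar> * ((t - x)\<^sup>2 / (\<alpha>1 * x\<^sup>2 + \<alpha>2 * x)) powr (\<zeta> / 2)"
proof -
  have pos: "0 < \<alpha>1 * y\<^sup>2 + \<alpha>2 * y" if "0 < y" for y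
    using that assms by (intro add_nonneg_pos) auto
  have less1: "\<bar>f t - f y\<bar> \<le> \<bar>C0\<bar> * ((t - y)\<^sup>2 / (\<alpha>1 * y\<^sup>2 + \<alpha>2 * y)) powr (\<zeta> / 2)"
    if y: "y \<in> {0<..<1}" for y
  proof -
    let ?A = "\<alpha>1 * y\<^sup>2 + \<alpha>2 * y"
    have A: "0 < ?A"
      using pos y by simp
    have sq: "\<bar>t - y\<bar> powr \<zeta> = (t - y)\<^sup>2 powr (\<zeta> / 2)"
      using powr_powr[of "\<bar>t - y\<bar>" 2 "\<zeta> / 2"] by simp
    have "\<bar>f t - f y\<bar> \<le> C0 * (\<bar>t - y\<bar> powr \<zeta> / (t + \<alpha>1 * y\<^sup>2 + \<alpha>2 * y) powr (\<zeta> / 2))"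
      using f t y unfolding Lip_def by blast
    \<comment> \<open>The sign of \<open>C0\<close> is free; a nonnegative factor is required before
      \<open>t\<close> is dropped from the denominator, which then no longer depends on
      \<open>t\<close>.\<close>
    also have "\<dots> \<le> \<bar>C0\<bar> * (\<bar>t - y\<bar> powr \<zeta> / (t + \<alpha>1 * y\<^sup>2 + \<alpha>2 * y) powr (\<zeta> / 2))"
      by (intro mult_right_mono) auto
    also have "\<dots> \<le> \<bar>C0\<bar> * (\<bar>t - y\<bar> powr \<zeta> / ?A powr (\<zeta> / 2))"
      using A t assms by (intro mult_left_mono divide_left_mono powr_mono2) auto
    finally show ?thesis
      using A by (simp add: sq powr_divide)
  qed
  \<comment> \<open>The space only constrains \<open>x < 1\<close>; the bound at \<open>x = 1\<close> is a limit.\<close>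
  show ?thesis
  proof (cases "x < 1")
    case True
    then show ?thesis using less1 x by simp
  next
    case False
    then have [simp]: "x = 1" using x by simp
    have cf: "continuous_on {0..1} f"
      using f by (simp add: Lip_def)
    have nt: "at (1::real) within {0<..<1} \<noteq> bot"
      by (simp add: trivial_limit_within islimpt_greaterThanLessThan2)
    have "(f \<longlongrightarrow> f 1) (at 1 within {0<..<1})"
      using cf unfolding continuous_on_def
      by (intro tendsto_within_subset[where S = "{0..1}" and T = "{0<..<1}"]) auto
    then have "((\<lambda>y. \<bar>f t - f y\<bar>) \<longlongrightarrow> \<bar>f t - f 1\<bar>) (at 1 within {0<..<1})"
      by (intro tendsto_intros)
    \<comment> \<open>For \<open>t = 1\<close> the base of the power tends to 0, so continuity of
      the power there rests on the positive exponent and the nonnegative base.\<close>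
    moreover have "((\<lambda>y. \<bar>C0\<bar> * ((t - y)\<^sup>2 / (\<alpha>1 * y\<^sup>2 + \<alpha>2 * y)) powr (\<zeta> / 2)) \<longlongrightarrow>
        \<bar>C0\<bar> * ((t - 1)\<^sup>2 / (\<alpha>1 * 1\<^sup>2 + \<alpha>2 * 1)) powr (\<zeta> / 2)) (at 1 within {0<..<1})"
      using assms pos[of 1]
      by (intro tendsto_mult tendsto_const tendsto_powr' tendsto_divide tendsto_power tendsto_diff
            tendsto_add tendsto_ident_at)
        (auto simp: eventually_at_filter intro!: always_eventually divide_nonneg_nonneg)
    moreover have "eventually (\<lambda>y. \<bar>f t - f y\<bar> \<le>
        \<bar>C0\<bar> * ((t - y)\<^sup>2 / (\<alpha>1 * y\<^sup>2 + \<alpha>2 * y)) powr (\<zeta> / 2)) (at 1 within {0<..<1})"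
      using less1 by (simp add: eventually_at_filter)
    ultimately show ?thesis
      using tendsto_le[OF nt] by simp
  qed
qed

text \<open>Young's inequality with exponents \<open>\<beta>\<close> and \<open>1 - \<beta>\<close>
  for the numbers \<open>s / \<delta>\<close> and 1, with \<open>s = 0\<close> treated
  apart.\<close>

lemma powr_le_tangent:
  fixes s \<delta> \<beta> :: real
  assumes "0 \<le> s" "0 < \<delta>" "0 < \<beta>" "\<beta> < 1"
  shows "s powr \<beta> \<le> \<delta> powr \<beta> * (1 - \<beta> + \<beta> * (s / \<delta>))"
proof -
  have "(s / \<delta>) powr \<beta> \<le> 1 - \<beta> + \<beta> * (s / \<delta>)"
    using Youngs_inequality_0[of \<beta> "1 - \<beta>" "s / \<delta>" 1] assms by (cases "s = 0") auto
  then have "\<delta> powr \<beta> * (s / \<delta>) powr \<beta> \<le> \<delta> powr \<beta> * (1 - \<beta> + \<beta> * (s / \<delta>))"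
    by (rule mult_left_mono) simp
  then show ?thesis
    using assms by (simp add: powr_divide)
qed

lemma durrmeyer_Lip:
  assumes f: "f \<in> Lip C0 \<alpha>1 \<alpha>2 \<zeta>" and \<alpha>: "\<alpha>1 \<ge> 0" "\<alpha>2 > 0" and \<zeta>: "0 < \<zeta>" "\<zeta> \<le> 1"
    and x: "x \<in> {0<..1}"
    and w: "\<And>k. k \<le> n \<Longrightarrow> 0 \<le> w k" "(\<Sum>k=0..n. w k) = 1"
    and \<delta>: "0 \<le> \<delta>" "durrmeyer n w (\<lambda>u. (u - x)\<^sup>2) \<le> \<delta>"
  shows "\<bar>durrmeyer n w f - f x\<bar> \<le> \<bar>C0\<bar> * (\<delta> / (\<alpha>1 * x\<^sup>2 + \<alpha>2 * x)) powr (\<zeta> / 2)"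
proof -
  define A where "A = \<alpha>1 * x\<^sup>2 + \<alpha>2 * x"
  define \<beta> where "\<beta> = \<zeta> / 2"
  have A: "0 < A"
    unfolding A_def using x \<alpha> by (intro add_nonneg_pos) auto
  have \<beta>: "0 < \<beta>" "\<beta> < 1"
    using \<zeta> by (auto simp: \<beta>_def)
  have cf: "continuous_on {0..1} f"
    using f by (simp add: Lip_def)
  have cs: "continuous_on {0..1} (\<lambda>u. (u - x)\<^sup>2)"
    by (intro continuous_intros)
  \<comment> \<open>\<open>\<delta>\<close> may be 0, while the point of tangency must be positive;
    hence a strictly larger \<open>\<epsilon>\<close>, which later decreases to
    \<open>\<delta>\<close>.\<close>
  have bound: "\<bar>durrmeyer n w f - f x\<bar> \<le> \<bar>C0\<bar> * (\<epsilon> / A) powr \<beta>" if \<epsilon>: "\<delta> < \<epsilon>" for \<epsilon>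
  proof -
    define c where "c = \<bar>C0\<bar> * (\<epsilon> / A) powr \<beta>"
    \<comment> \<open>The tangent at \<open>\<epsilon> / A\<close>, scaled by
      \<open>\<bar>C0\<bar>\<close> and read as \<open>p + q * (u - x)\<^sup>2\<close>. Replacing
      the square by \<open>\<epsilon>\<close> returns the value at the point of tangency:
      \<open>p + q * \<epsilon> = c\<close>.\<close>
    define p q where "p = c * (1 - \<beta>)" and "q = c * \<beta> / \<epsilon>"
    have \<epsilon>0: "0 < \<epsilon>"
      using \<epsilon> \<delta> by simp
    have c0: "0 \<le> c"
      by (simp add: c_def)
    have fb: "\<bar>f u - f x\<bar> \<le> p + q * (u - x)\<^sup>2" if "u \<in> {0..1}" for u
    proof -
      have "\<bar>f u - f x\<bar> \<le> \<bar>C0\<bar> * ((u - x)\<^sup>2 / A) powr \<beta>"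
        unfolding A_def \<beta>_def using Lip_bound[OF f \<alpha> \<zeta>(1) that x] .
      also have "\<dots> \<le> \<bar>C0\<bar> * ((\<epsilon> / A) powr \<beta> * (1 - \<beta> + \<beta> * ((u - x)\<^sup>2 / A / (\<epsilon> / A))))"
        using A \<epsilon>0 \<beta> by (intro mult_left_mono powr_le_tangent) auto
      also have "(u - x)\<^sup>2 / A / (\<epsilon> / A) = (u - x)\<^sup>2 / \<epsilon>"
        using A by simp
      also have "\<bar>C0\<bar> * ((\<epsilon> / A) powr \<beta> * (1 - \<beta> + \<beta> * ((u - x)\<^sup>2 / \<epsilon>))) = p + q * (u - x)\<^sup>2"
        by (simp add: p_def q_def c_def algebra_simps)
      finally show ?thesis .
    qed
    \<comment> \<open>\<open>f\<close> is squeezed between two functions affine in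
      \<open>(u - x)\<^sup>2\<close>, whose images under the functional are known exactly in terms
      of the second moment.\<close>
    have "durrmeyer n w f \<le> durrmeyer n w (\<lambda>u. (f x + p) + q * (u - x)\<^sup>2)"
      by (rule durrmeyer_mono)
        (use w cf fb in \<open>auto intro!: continuous_intros simp: abs_le_iff algebra_simps\<close>)
    moreover have "durrmeyer n w (\<lambda>u. (f x - p) + (- q) * (u - x)\<^sup>2) \<le> durrmeyer n w f"
      by (rule durrmeyer_mono)
        (use w cf fb in \<open>auto intro!: continuous_intros simp: abs_le_iff algebra_simps\<close>)
    ultimately have "\<bar>durrmeyer n w f - f x\<bar> \<le> p + q * durrmeyer n w (\<lambda>u. (u - x)\<^sup>2)"
      unfolding durrmeyer_affine[OF w(2) cs] by simp
    also have "\<dots> \<le> p + q * \<epsilon>"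
      using \<delta> \<epsilon> c0 \<beta> \<epsilon>0 by (intro add_left_mono mult_left_mono) (auto simp: q_def)
    also have "\<dots> = c"
      using \<epsilon>0 by (simp add: p_def q_def algebra_simps)
    finally show ?thesis
      by (simp add: c_def)
  qed
  have "((\<lambda>\<epsilon>. \<bar>C0\<bar> * (\<epsilon> / A) powr \<beta>) \<longlongrightarrow> \<bar>C0\<bar> * (\<delta> / A) powr \<beta>) (at_right \<delta>)"
    using \<beta> A \<delta>
    by (intro tendsto_mult tendsto_const tendsto_powr' tendsto_divide tendsto_ident_at)
      (auto simp: eventually_at_filter intro!: always_eventually)
  moreover have "eventually (\<lambda>\<epsilon>. \<bar>durrmeyer n w f - f x\<bar> \<le> \<bar>C0\<bar> * (\<epsilon> / A) powr \<beta>) (at_right \<delta>)"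
    using bound by (simp add: eventually_at_filter)
  ultimately show ?thesis
    unfolding A_def[symmetric] \<beta>_def[symmetric]
    by (intro tendsto_lowerbound[where F = "at_right \<delta>"]) auto
qed

theorem theorem2:
  fixes C0 :: real
  shows "\<exists>C>0. \<forall>(\<alpha>1::real) (\<alpha>2::real) (\<zeta>::real) (\<mu>::real) (f::real \<Rightarrow> real)
            (a0::nat \<Rightarrow> real) (a1::nat \<Rightarrow> real) (B::real).
      \<alpha>1 \<ge> 0 \<longrightarrow> \<alpha>2 > 0 \<longrightarrow> 0 < \<zeta> \<longrightarrow> \<zeta> \<le> 1 \<longrightarrow> \<mu> \<ge> 1 \<longrightarrow> f \<in> Lip C0 \<alpha>1 \<alpha>2 \<zeta> \<longrightarrow>
      (\<forall>n\<ge>1. 2 * a0 n + a1 n = 1) \<longrightarrow> B > 0 \<longrightarrow>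
      (\<forall>n\<ge>1. (\<forall>k\<le>n. \<forall>y\<in>{0..1}. 0 \<le> JM a0 a1 n k y) \<longrightarrow>
         (\<forall>x\<in>{0<..1}.
            DM a0 a1 n (\<lambda>u. (u - x)\<^sup>2) x \<le> B / (real n + 2) * phi2 x \<longrightarrow>
            \<bar>DM_Bezier a0 a1 \<mu> n f x - f x\<bar>
              \<le> C * (\<mu> * B * phi2 x / ((real n + 2) * (\<alpha>1 * x\<^sup>2 + \<alpha>2 * x))) powr (\<zeta> / 2)))"
proof (intro exI[of _ "\<bar>C0\<bar> + 1"] conjI allI impI ballI)
  \<comment> \<open>The summand 1 keeps the constant positive when \<open>C0 = 0\<close>.\<close>
  show "0 < \<bar>C0\<bar> + 1"
    by simp
next
  fix \<alpha>1 \<alpha>2 \<zeta> \<mu> B x :: real and f :: "real \<Rightarrow> real" and a0 a1 :: "nat \<Rightarrow> real" and n :: nat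
  assume \<alpha>: "\<alpha>1 \<ge> 0" "\<alpha>2 > 0" and \<zeta>: "0 < \<zeta>" "\<zeta> \<le> 1" and \<mu>: "\<mu> \<ge> 1"
    and f: "f \<in> Lip C0 \<alpha>1 \<alpha>2 \<zeta>" and a: "\<forall>n\<ge>1. 2 * a0 n + a1 n = 1" and B: "B > 0"
    and n: "1 \<le> n" and J: "\<forall>k\<le>n. \<forall>y\<in>{0..1}. 0 \<le> JM a0 a1 n k y" and x: "x \<in> {0<..1}"
    and D: "DM a0 a1 n (\<lambda>u. (u - x)\<^sup>2) x \<le> B / (real n + 2) * phi2 x"
  have s: "(\<Sum>k=0..n. pM a0 a1 n k x) = 1"
    using a n by (intro sum_pM) auto
  have p: "0 \<le> pM a0 a1 n k x" for k
    using a n J x by (intro pM_nonneg) auto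
  let ?w = "\<lambda>k. QM a0 a1 \<mu> n k x"
  \<comment> \<open>\<open>\<mu>\<close> times the assumed bound on the second moment of
    \<open>DM\<close>; it is 0 at \<open>x = 1\<close>.\<close>
  define \<delta> where "\<delta> = \<mu> * (B / (real n + 2) * phi2 x)"
  have "durrmeyer n ?w (\<lambda>u. (u - x)\<^sup>2) \<le> \<mu> * durrmeyer n (\<lambda>k. pM a0 a1 n k x) (\<lambda>u. (u - x)\<^sup>2)"
    using QM_bounds(2)[OF p s \<mu>] by (intro durrmeyer_mono_weights continuous_intros) auto
  also have "\<dots> \<le> \<delta>"
    unfolding \<delta>_def using D \<mu> by (intro mult_left_mono) (auto simp: durrmeyer_def DM_def)
  finally have "durrmeyer n ?w (\<lambda>u. (u - x)\<^sup>2) \<le> \<delta>" .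
  moreover have "0 \<le> \<delta>"
    using x B \<mu> by (simp add: \<delta>_def phi2_def)
  ultimately have "\<bar>durrmeyer n ?w f - f x\<bar> \<le> \<bar>C0\<bar> * (\<delta> / (\<alpha>1 * x\<^sup>2 + \<alpha>2 * x)) powr (\<zeta> / 2)"
    using QM_bounds(1)[OF p s \<mu>] sum_QM[OF s] by (intro durrmeyer_Lip[OF f \<alpha> \<zeta> x]) auto
  also have "\<dots> \<le> (\<bar>C0\<bar> + 1) * (\<delta> / (\<alpha>1 * x\<^sup>2 + \<alpha>2 * x)) powr (\<zeta> / 2)"
    by (intro mult_right_mono) auto
  also have "\<delta> / (\<alpha>1 * x\<^sup>2 + \<alpha>2 * x) = \<mu> * B * phi2 x / ((real n + 2) * (\<alpha>1 * x\<^sup>2 + \<alpha>2 * x))"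
    by (simp add: \<delta>_def)
  finally show "\<bar>DM_Bezier a0 a1 \<mu> n f x - f x\<bar>
      \<le> (\<bar>C0\<bar> + 1) * (\<mu> * B * phi2 x / ((real n + 2) * (\<alpha>1 * x\<^sup>2 + \<alpha>2 * x))) powr (\<zeta> / 2)"
    by (simp add: durrmeyer_def DM_Bezier_def)
qed

end
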